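(* Let $f(X)=a_nX^n+\cdots+a_1X+a_0$ be a polynomial with real coefficients, with $n\ge 1$ and $a_n>0$, and denote by $j_1<j_2<\cdots<j_\ell$ ($\ell\ge 1$) the indices $j$ for which $a_j<0$. Let $\lambda_1,\dots,\lambda_\ell$ be arbitrary positive real numbers with $\lambda_1+\cdots+\lambda_\ell=1$, and define $$v=\max_{1\le i\le \ell}\left(\frac{|a_{j_i}|}{\lambda_i a_n}\right)^{\frac{1}{n-j_i}}.$$ Then $f$ has no zero in the sector $S_{v,\frac{\pi}{n}}$.
   Context: For real numbers $v,\theta$ with $0<\theta\le\pi$, define the open sector $S_{v,\theta}=\{z=v+\rho e^{i\varphi}\in\mathbb{C}:\rho>0,\ |\varphi|<\theta\}$ (with $\varphi$ real). *)

theory Defs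
  imports Complex_Main "HOL-Computational_Algebra.Polynomial"
begin

text \<open>Intended for \<open>0 < \<theta> \<le> pi\<close>. The sector is open and does not contain its apex \<open>v\<close>.\<close>

definition open_sector :: "real \<Rightarrow> real \<Rightarrow> complex set" where
  "open_sector v \<theta> =
     {z. \<exists>\<rho> \<phi>. \<rho> > 0 \<and> \<bar>\<phi>\<bar> < \<theta> \<and> z = of_real v + of_real \<rho> * exp (\<i> * of_real \<phi>)}"

end

theory Submission imports Defs begin

text \<open>Expanding \<open>f\<close> around \<open>v\<close>, the term \<open>\<lambda>\<^sub>i a\<^sub>n x\<^sup>n\<close> compensates the negative term of index \<open>j\<^sub>i\<close> in
  every Taylor coefficient, so all coefficients of \<open>f(v + X)\<close> are nonnegative. At a point of
  argument \<open>\<phi>\<close> with \<open>|\<phi>| < pi / n\<close>, rotating by \<open>- n \<phi> / 2\<close> moves all the powers of exponent at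
  most \<open>n\<close> into the open right half-plane, so a nonnegative combination of them cannot vanish.\<close>

lemma poly_nonneg_coeffs_nonzero_in_sector:
  fixes q :: "real poly"
  assumes nonneg: "\<And>k. coeff q k \<ge> 0" and "q \<noteq> 0"
    and "\<rho> > 0" and phi: "real (degree q) * \<bar>\<phi>\<bar> < pi"
  shows "poly (map_poly complex_of_real q) (rcis \<rho> \<phi>) \<noteq> 0"
proof
  define n where "n = degree q"
  assume zero: "poly (map_poly complex_of_real q) (rcis \<rho> \<phi>) = 0"
  \<comment> \<open>Centering the exponents at n/2 puts them in [-n/2, n/2], so each rotated angle
    is at most n|\<phi>|/2 < pi/2 in absolute value.\<close>
  have cos_pos: "cos ((real k - real n / 2) * \<phi>) > 0" if "k \<le> n" for k
  proof -
    have "\<bar>real k - real n / 2\<bar> \<le> real n / 2" using that by (auto simp: abs_if)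
    then have "\<bar>(real k - real n / 2) * \<phi>\<bar> \<le> real n / 2 * \<bar>\<phi>\<bar>"
      by (simp only: abs_mult) (rule mult_right_mono, auto)
    also have "\<dots> < pi / 2" using phi by (simp add: n_def)
    finally show ?thesis by (intro cos_gt_zero_pi) linarith+
  qed
  define \<alpha> where "\<alpha> = real n / 2 * \<phi>"
  have rotate: "cis (- \<alpha>) * (of_real c * rcis \<rho> \<phi> ^ k) =
      of_real (c * \<rho> ^ k) * cis ((real k - real n / 2) * \<phi>)" for c k
    by (simp only: DeMoivre2 cis_rcis_eq rcis_mult mult.left_commute[of "rcis 1 (- \<alpha>)"])
      (simp add: rcis_def \<alpha>_def left_diff_distrib)
  have degree: "degree (map_poly complex_of_real q) = n"
    by (simp add: n_def degree_map_poly)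
  have "0 = Re (cis (- \<alpha>) * poly (map_poly complex_of_real q) (rcis \<rho> \<phi>))"
    using zero by simp
  also have "\<dots> = Re (\<Sum>k\<le>n. of_real (coeff q k * \<rho> ^ k) * cis ((real k - real n / 2) * \<phi>))"
    by (simp only: poly_altdef sum_distrib_left coeff_map_poly of_real_0 degree rotate)
  also have "\<dots> = (\<Sum>k\<le>n. coeff q k * \<rho> ^ k * cos ((real k - real n / 2) * \<phi>))"
    by simp
  also have "\<dots> > 0"
  proof (rule sum_pos2[of _ n])
    \<comment> \<open>Lower coefficients may all vanish; strict positivity of the sum comes from the
      leading term.\<close>
    have "coeff q n > 0"
      using nonneg[of n] \<open>q \<noteq> 0\<close> by (simp add: n_def less_le)
    then show "0 < coeff q n * \<rho> ^ n * cos ((real n - real n / 2) * \<phi>)"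
      using cos_pos[of n] \<open>\<rho> > 0\<close> by (intro mult_pos_pos) auto
    show "0 \<le> coeff q k * \<rho> ^ k * cos ((real k - real n / 2) * \<phi>)" if "k \<in> {..n}" for k
      using cos_pos[of k] that \<open>\<rho> > 0\<close> nonneg[of k] by (intro mult_nonneg_nonneg) auto
  qed auto
  finally show False by simp
qed

text \<open>Binomial expansion of each power of \<open>[:c, 1:]\<close>. For i < k the binomial
  coefficient is 0, so the truncated difference \<open>i - k\<close> does no harm.\<close>

lemma coeff_pcompose_translate:
  fixes p :: "'a::comm_ring_1 poly"
  shows "coeff (p \<circ>\<^sub>p [:c, 1:]) k = (\<Sum>i\<le>degree p. coeff p i * (of_nat (i choose k) * c ^ (i - k)))"
proof -
  have *: "coeff ([:c, 1:] ^ i) k = of_nat (i choose k) * c ^ (i - k)" for i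
  proof (cases "k \<le> i")
    case True
    then show ?thesis by (simp add: coeff_linear_poly_power)
  next
    case False
    have "degree ([:c, 1:] ^ i) \<le> i"
      using degree_power_le[of "[:c, 1:]" i] by simp
    with False have "coeff ([:c, 1:] ^ i) k = 0" by (intro coeff_eq_0) linarith
    with False show ?thesis by (simp add: binomial_eq_0)
  qed
  have "p \<circ>\<^sub>p [:c, 1:] = (\<Sum>i\<le>degree p. smult (coeff p i) ([:c, 1:] ^ i))"
    by (simp add: pcompose_altdef poly_altdef coeff_map_poly degree_map_poly)
  then show ?thesis by (simp add: coeff_sum *)
qed

text \<open>Compares the k-th Taylor coefficients at v of v^(n-j) X^j and X^n. For k \<le> j both
  carry the same power v^(n-k), and binomial coefficients increase in the upper index; for k > j the
  left side is 0.\<close>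

lemma choose_mult_power_le:
  fixes v :: real
  assumes "v \<ge> 0" and "j \<le> n"
  shows "v ^ (n - j) * (real (j choose k) * v ^ (j - k)) \<le> real (n choose k) * v ^ (n - k)"
proof (cases "k \<le> j")
  case True
  then have "v ^ (n - j) * v ^ (j - k) = v ^ (n - k)"
    using \<open>j \<le> n\<close> by (simp flip: power_add)
  moreover have "real (j choose k) * v ^ (n - k) \<le> real (n choose k) * v ^ (n - k)"
    using assms by (intro mult_right_mono) (auto intro: binomial_right_mono)
  ultimately show ?thesis by (simp add: mult.left_commute)
next
  case False
  then show ?thesis using assms by (simp add: binomial_eq_0)
qed

theorem theorem2p7:
  fixes f :: "real poly" and n l :: nat and j :: "nat \<Rightarrow> nat"
    and lam :: "nat \<Rightarrow> real" and v :: real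
  assumes "n = degree f" and "n \<ge> 1" and "coeff f n > 0"
    and "l \<ge> 1" and "strict_mono_on {1..l} j"
    and "j ` {1..l} = {k. coeff f k < 0}"
    and "\<And>i. i \<in> {1..l} \<Longrightarrow> lam i > 0"
    and "(\<Sum>i = 1..l. lam i) = 1"
    and "v = Max ((\<lambda>i. (\<bar>coeff f (j i)\<bar> / (lam i * coeff f n)) powr (1 / (real n - real (j i)))) ` {1..l})"
  shows "\<not> (\<exists>z \<in> open_sector v (pi / real n). poly (map_poly complex_of_real f) z = 0)"
proof
  define a where "a = coeff f n"
  define r where "r i = (\<bar>coeff f (j i)\<bar> / (lam i * a)) powr (1 / (real n - real (j i)))" for i
  define q where "q = f \<circ>\<^sub>p [:v, 1:]"
  have a: "a > 0" using assms(3) by (simp add: a_def)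
  have neg: "coeff f (j i) < 0" if "i \<in> {1..l}" for i
    using assms(6) that by blast
  have j_less: "j i < n" if "i \<in> {1..l}" for i
    using neg[OF that] assms(1,3) by (metis coeff_eq_0 less_irrefl linorder_neqE_nat not_less_iff_gr_or_eq)
  have r_le: "r i \<le> v" if "i \<in> {1..l}" for i
    using that unfolding assms(9) r_def a_def by (intro Max_ge) auto
  have v: "v \<ge> 0"
    using r_le[of 1] assms(4) by (auto simp: r_def intro: order_trans[OF powr_ge_zero])
  have bound: "\<bar>coeff f (j i)\<bar> \<le> lam i * a * v ^ (n - j i)" if i: "i \<in> {1..l}" for i
  proof -
    \<comment> \<open>The quotient is positive and \<open>j i < n\<close>, so this power undoes the
      root in \<open>r i\<close>.\<close>
    have "r i ^ (n - j i) = \<bar>coeff f (j i)\<bar> / (lam i * a)"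
      using neg[OF i] j_less[OF i] assms(7)[OF i] a
      by (simp add: r_def of_nat_diff powr_powr flip: powr_realpow)
    moreover have "r i ^ (n - j i) \<le> v ^ (n - j i)"
      by (intro power_mono r_le i) (simp add: r_def)
    ultimately show ?thesis
      using assms(7)[OF i] a by (simp add: pos_divide_le_eq mult.commute)
  qed
  have q_nonneg: "coeff q k \<ge> 0" for k
  proof -
    \<comment> \<open>The k-th Taylor coefficient of X^i at v, so that \<open>coeff q k\<close> is
      the sum of all \<open>coeff f i * c i\<close>.\<close>
    define c where "c i = real (i choose k) * v ^ (i - k)" for i
    have c: "c i \<ge> 0" for i using v by (simp add: c_def)
    \<comment> \<open>The share \<open>lam i\<close> of the leading contribution
      \<open>a * c n\<close> pays for the i-th negative term; as the shares add up to 1, the leading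
      term pays for all of them.\<close>
    have "- (coeff f (j i) * c (j i)) \<le> lam i * (a * c n)" if i: "i \<in> {1..l}" for i
    proof -
      have "- (coeff f (j i) * c (j i)) = \<bar>coeff f (j i)\<bar> * c (j i)"
        using neg[OF i] by simp
      also have "\<dots> \<le> lam i * a * v ^ (n - j i) * c (j i)"
        by (intro mult_right_mono bound i c)
      also have "\<dots> = lam i * a * (v ^ (n - j i) * c (j i))" by simp
      also have "\<dots> \<le> lam i * a * c n"
        using assms(7)[OF i] a j_less[OF i] v unfolding c_def
        by (intro mult_left_mono choose_mult_power_le) auto
      finally show ?thesis by simp
    qed
    then have "(\<Sum>i = 1..l. - (coeff f (j i) * c (j i))) \<le> (\<Sum>i = 1..l. lam i * (a * c n))"
      by (intro sum_mono) auto
    also have "\<dots> = a * c n" using assms(8) by (simp flip: sum_distrib_right)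
    finally have "0 \<le> a * c n + (\<Sum>i = 1..l. coeff f (j i) * c (j i))"
      by (simp add: sum_negf)
    also have "(\<Sum>i = 1..l. coeff f (j i) * c (j i)) = (\<Sum>i\<in>j ` {1..l}. coeff f i * c i)"
      using strict_mono_on_imp_inj_on[OF assms(5)] by (simp add: sum.reindex)
    \<comment> \<open>By \<open>assms(6)\<close> the indices outside the range of \<open>j\<close>
      have nonnegative coefficients, so including them cannot lower the sum.\<close>
    also have "\<dots> \<le> (\<Sum>i<n. coeff f i * c i)"
    proof (rule sum_mono2)
      show "j ` {1..l} \<subseteq> {..<n}" using j_less by auto
      show "0 \<le> coeff f i * c i" if "i \<in> {..<n} - j ` {1..l}" for i
        using that c unfolding assms(6) by (auto intro!: mult_nonneg_nonneg)
    qed simp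
    also have "a * c n + (\<Sum>i<n. coeff f i * c i) = coeff q k"
      by (simp add: q_def coeff_pcompose_translate c_def a_def lessThan_Suc_atMost[symmetric]
          flip: assms(1))
    finally show ?thesis by simp
  qed
  have deg_q: "degree q = n" by (simp add: q_def assms(1) degree_pcompose)
  have "q \<noteq> 0" using deg_q assms(2) by auto
  assume "\<exists>z \<in> open_sector v (pi / real n). poly (map_poly complex_of_real f) z = 0"
  then obtain \<rho> \<phi> where "\<rho> > 0" and phi: "\<bar>\<phi>\<bar> < pi / real n"
    and zero: "poly (map_poly complex_of_real f) (of_real v + rcis \<rho> \<phi>) = 0"
    by (auto simp: open_sector_def rcis_def cis_conv_exp)
  \<comment> \<open>Translation by the real number v commutes with the embedding into the complex
    numbers, so a zero of f at v + w is a zero of \<open>q\<close> at w.\<close>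
  have "map_poly complex_of_real q = map_poly complex_of_real f \<circ>\<^sub>p [:of_real v, 1:]"
    by (intro poly_eqI)
      (simp add: q_def coeff_map_poly coeff_pcompose_translate degree_map_poly)
  then have "poly (map_poly complex_of_real q) (rcis \<rho> \<phi>) = 0"
    using zero by (simp add: poly_pcompose)
  moreover have "real (degree q) * \<bar>\<phi>\<bar> < pi"
    using phi assms(2) by (simp add: deg_q field_simps)
  ultimately show False
    using poly_nonneg_coeffs_nonzero_in_sector q_nonneg \<open>q \<noteq> 0\<close> \<open>\<rho> > 0\<close> by blast
qed

end
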